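(* Let $X\subseteq\mathbb{R}^n$ be nonempty, closed, convex and bounded, let $f_1,\dots,f_m:\mathbb{R}^n\to\mathbb{R}$ be convex, let $f=\sum_{i=1}^m f_i$, $f^*=\min_{x\in X}f(x)$ and $X^*=\{x\in X:f(x)=f^*\}$. Let $\{x_k\}$ be generated by the Markov randomized incremental stochastic subgradient method $$x_{k+1}=\mathcal{P}_X\big[x_k-\alpha_{k+1}\big(\nabla f_{s(k+1)}(x_k)+\epsilon_{s(k+1),k+1}\big)\big],\qquad k\ge0,$$ with a random initial vector $x_0\in X$, where $\{s(k)\}_{k\ge0}$ is a time non-homogeneous Markov chain on $\{1,\dots,m\}$ with transition matrices $P(k)$, satisfying the following conditions. (i) There is an integer $Q\ge1$ such that for all $k\ge 0$ the directed graph with vertex set $\{1,\dots,m\}$ and edge set $\bigcup_{\ell=k}^{k+Q-1}E(\ell)$ is strongly connected, where $E(\ell)=\{(i,j):[P(\ell)]_{i,j}>0\}$. (ii) For each $k$ all diagonal entries of $P(k)$ are positive; there is a scalar $\eta>0$ such that for all $i,j,k$, $[P(k)]_{i,j}>0$ implies $[P(k)]_{i,j}>\eta$; and $P(k)$ is doubly stochastic for each $k$. (iii) For deterministic nonnegative sequences $\{\mu_k\},\{\nu_k\}$ and all $k\ge0$, $$\big\|\mathsf{E}[\epsilon_{s(k+1),k+1}\mid G_k]\big\|\le\mu_{k+1},\qquad \mathsf{E}\big[\|\epsilon_{s(k+1),k+1}\|^2\mid G_k\big]\le\nu_{k+1}^2 .$$ Assume that $\alpha_k=\frac{a}{k^p}$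 for $k\ge1$, where $a>0$ and $\frac23<p\le1$, and that $$\sum_{k=1}^\infty\alpha_k\mu_k<\infty,\qquad \nu=\sup_{k\ge1}\nu_k<\infty .$$ Then, with probability 1, $$\liminf_{k\to\infty}f(x_k)=f^*,\qquad \liminf_{k\to\infty}\mathrm{dist}(x_k,X^* )=0 .$$
   Context: $\|\cdot\|$ is the Euclidean norm, $\mathcal{P}_X$ is the Euclidean projection onto $X$, and $\mathrm{dist}(x,X^* )=\inf_{y\in X^*}\|x-y\|$. A vector $v$ is a subgradient of a convex function $g:\mathbb{R}^n\to\mathbb{R}$ at $x$ if $v^T(y-x)\le g(y)-g(x)$ for all $y\in\mathbb{R}^n$; $\nabla f_i(x)$ denotes a (chosen) subgradient of $f_i$ at $x$. All random quantities live on one probability space. $G_k$ is the $\sigma$-algebra of the entire history of the method up to time $k$, generated by $x_0$, $s(0),\dots,s(k)$ and the errors $\epsilon_{s(n),n}$, $1\le n\le k$. The Markov property is with respect to this history: $\mathsf{Prob}\{s(k+1)=j\mid G_k\}=[P(k)]_{s(k),j}$ for all $j$ and $k\ge0$. The subgradients are selected so that $x_k$ is $G_k$-measurable. *)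

theory Defs
  imports "HOL-Probability.Probability" "Graph_Theory.Digraph_Component"
begin

definition is_subgradient :: "('b::real_inner \<Rightarrow> real) \<Rightarrow> 'b \<Rightarrow> 'b \<Rightarrow> bool" where
  "is_subgradient g x v \<longleftrightarrow> (\<forall>y. v \<bullet> (y - x) \<le> g y - g x)"

(* LEAST is used as the minimum of the set of values on X; it is meaningful
   only when that minimum is attained. *)
definition min_value :: "('b \<Rightarrow> real) \<Rightarrow> 'b set \<Rightarrow> real" where
  "min_value F X = (LEAST v. v \<in> F ` X)"

definition minimizers :: "('b \<Rightarrow> real) \<Rightarrow> 'b set \<Rightarrow> 'b set" where
  "minimizers F X = {x \<in> X. F x = min_value F X}"

definition doubly_stochastic :: "real ^ 'm ^ 'm \<Rightarrow> bool" where
  "doubly_stochastic A \<longleftrightarrow>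
     (\<forall>i j. 0 \<le> A $ i $ j) \<and> (\<forall>i. (\<Sum>j\<in>UNIV. A $ i $ j) = 1) \<and> (\<forall>j. (\<Sum>i\<in>UNIV. A $ i $ j) = 1)"

definition positive_entries :: "real ^ 'm ^ 'm \<Rightarrow> ('m \<times> 'm) set" where
  "positive_entries A = {(i, j). 0 < A $ i $ j}"

definition transition_graph ::
    "(nat \<Rightarrow> real ^ 'm ^ 'm) \<Rightarrow> nat \<Rightarrow> nat \<Rightarrow> 'm pair_pre_digraph" where
  "transition_graph P Q k =
     \<lparr> pverts = UNIV, parcs = (\<Union>l\<in>{k..k + Q - 1}. positive_entries (P l)) \<rparr>"

(* The sigma-algebra generated by x0, by s 0, ..., s k and by e 1, ..., e k, where e n
   is the error that enters the method at step n. States carry the discrete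
   sigma-algebra. As a measure, sigma is null; only its sets matter here. *)
definition history ::
    "'a measure \<Rightarrow> ('a \<Rightarrow> 'b::topological_space) \<Rightarrow> (nat \<Rightarrow> 'a \<Rightarrow> 'm) \<Rightarrow> (nat \<Rightarrow> 'a \<Rightarrow> 'b) \<Rightarrow> nat \<Rightarrow> 'a measure"
  where
  "history M x0 s e k = sigma (space M)
     ({x0 -` A \<inter> space M | A. A \<in> sets borel} \<union>
      {s n -` B \<inter> space M | n B. n \<le> k} \<union>
      {e n -` A \<inter> space M | n A. 1 \<le> n \<and> n \<le> k \<and> A \<in> sets borel})"

(* Componentwise, because the library has conditional expectations of scalar functions only. *)
definition vec_cond_exp ::
    "'a measure \<Rightarrow> 'a measure \<Rightarrow> ('a \<Rightarrow> real ^ 'n) \<Rightarrow> 'a \<Rightarrow> real ^ 'n" where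
  "vec_cond_exp M F Y \<omega> = (\<chi> i. real_cond_exp M F (\<lambda>\<omega>'. Y \<omega>' $ i) \<omega>)"

end

theory Submission
  imports Defs
begin

text \<open>
  The whole argument takes place in expectation. Let \<open>y\<close> be a minimizer of \<open>F\<close> on \<open>X\<close> and let \<open>A k\<close>
  be the step size leading from \<open>x k\<close> to \<open>x (k + 1)\<close>. Expanding the square and using that
  the projection is nonexpansive (\<open>expected_projected_step\<close>), the expected squared
  distance to \<open>y\<close> decreases in one step by \<open>2 * A k\<close> times the expectation of
  \<open>f (s (k + 1)) (x k) - f (s (k + 1)) y\<close>, up to two kinds of error: the conditional means of the noise,
  which contribute \<open>A k * \<mu> (k + 1)\<close>, and terms of order \<open>(A k)\<^sup>2\<close>. Both are summable.

  If the component were drawn uniformly and independently of the past, that expectation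
  would be the expected optimality gap \<open>F (x k) - F y\<close> divided by the number of components. The
  chain comes close to this. Products of its transition matrices approach the matrix
  with all entries equal at a geometric rate (\<open>trans_prod_mixing\<close>), so the component used at
  time \<open>k + 1\<close> is almost uniform given the state some time ago, while the point has moved
  little since then. Quantitatively (\<open>markov_sampling_bias\<close>), the discrepancy at time \<open>k\<close> is, up to
  constants, at most a geometrically decaying term plus the convolution of a geometric sequence with
  the step sizes. Multiplied by \<open>A k\<close>, the latter is dominated by a convolution of two summable
  sequences, since the step sizes decrease and have summable squares.

  Consequently the expectations of \<open>A k * (F (x k) - F y)\<close> form a convergent series. The terms are
  nonnegative, so by monotone convergence the series of the random variables themselves
  converges almost surely. As the step sizes are not summable, the optimality gap cannot stay away
  from zero; compactness of \<open>X\<close> turns this into the statement about distances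
  (\<open>liminf_minimizing\<close>).
\<close>

section \<open>Geometric mixing of doubly stochastic chains\<close>

text \<open>
  The matrix \<open>P n ** \<dots> ** P (n + t - 1)\<close> of transition probabilities from time \<open>n\<close> to time
  \<open>n + t\<close>. The recursion splits off the earliest factor: positivity, contraction and the
  Markov property are all propagated backwards in time.
\<close>
fun trans_prod :: "(nat \<Rightarrow> real ^ 'm ^ 'm) \<Rightarrow> nat \<Rightarrow> nat \<Rightarrow> real ^ 'm ^ 'm" where
  "trans_prod P n 0 = mat 1"
| "trans_prod P n (Suc t) = P n ** trans_prod P (Suc n) t"

lemma trans_prod_add:
  "trans_prod P n (t + u) = trans_prod P n t ** trans_prod P (n + t) u"
  by (induction t arbitrary: n) (simp_all add: matrix_mul_assoc)

lemma doubly_stochastic_mult: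
  assumes "doubly_stochastic A" "doubly_stochastic B"
  shows "doubly_stochastic (A ** B)"
  unfolding doubly_stochastic_def
proof (intro conjI allI)
  fix i j
  show "0 \<le> (A ** B) $ i $ j"
    using assms by (auto simp: doubly_stochastic_def matrix_matrix_mult_def intro!: sum_nonneg)
next
  fix i
  have "(\<Sum>j\<in>UNIV. (A ** B) $ i $ j) = (\<Sum>k\<in>UNIV. A $ i $ k * (\<Sum>j\<in>UNIV. B $ k $ j))"
    by (simp add: matrix_matrix_mult_def sum_distrib_left, rule sum.swap)
  then show "(\<Sum>j\<in>UNIV. (A ** B) $ i $ j) = 1"
    using assms by (simp add: doubly_stochastic_def)
next
  fix j
  have "(\<Sum>i\<in>UNIV. (A ** B) $ i $ j) = (\<Sum>k\<in>UNIV. (\<Sum>i\<in>UNIV. A $ i $ k) * B $ k $ j)"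
    by (simp add: matrix_matrix_mult_def sum_distrib_right, rule sum.swap)
  then show "(\<Sum>i\<in>UNIV. (A ** B) $ i $ j) = 1"
    using assms by (simp add: doubly_stochastic_def)
qed

lemma doubly_stochastic_mat_1: "doubly_stochastic (mat 1 :: real ^ 'm ^ 'm)"
  by (auto simp: doubly_stochastic_def mat_def)

lemma doubly_stochastic_trans_prod:
  assumes "\<And>k. doubly_stochastic (P k)"
  shows "doubly_stochastic (trans_prod P n t)"
  using assms by (induction t arbitrary: n) (simp_all add: doubly_stochastic_mat_1 doubly_stochastic_mult)

lemma doubly_stochastic_entry_le_1:
  assumes "doubly_stochastic A"
  shows "A $ i $ j \<le> 1"
proof -
  have "A $ i $ j \<le> (\<Sum>j\<in>UNIV. A $ i $ j)"
    using assms by (intro member_le_sum) (auto simp: doubly_stochastic_def)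
  then show ?thesis using assms by (simp add: doubly_stochastic_def)
qed

text \<open>
  Along a path from a vertex outside \<open>S\<close> to a vertex inside \<open>S\<close>, some arc crosses the border.
\<close>
lemma strongly_connected_edge_into:
  assumes sc: "strongly_connected (transition_graph P Q k)" and "Q \<ge> 1"
    and "S \<noteq> {}" "S \<noteq> UNIV"
  obtains l u v where "k \<le> l" "l < k + Q" "u \<notin> S" "v \<in> S" "P l $ u $ v > 0"
proof -
  let ?G = "with_proj (transition_graph P Q k)"
  obtain a b where ab: "a \<notin> S" "b \<in> S" using assms by blast
  have "a \<rightarrow>\<^sup>*\<^bsub>?G\<^esub> b"
    using sc by (auto simp: strongly_connected_def transition_graph_def)
  then have "(a, b) \<in> rtrancl_on (verts ?G) (arcs_ends ?G)"
    by (simp add: reachable_def)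
  then have "b \<in> S \<longrightarrow> (\<exists>u v. u \<notin> S \<and> v \<in> S \<and> (u, v) \<in> arcs_ends ?G)"
  proof (induction rule: rtrancl_on_induct)
    case base
    then show ?case using ab by simp
  next
    case (step y z)
    then show ?case by blast
  qed
  then obtain u v where uv: "u \<notin> S" "v \<in> S" "(u, v) \<in> arcs_ends ?G" using ab by blast
  then obtain l where "l \<in> {k..k + Q - 1}" "P l $ u $ v > 0"
    by (auto simp: arcs_ends_def arc_to_ends_def transition_graph_def positive_entries_def)
  with uv assms(2) that show thesis by auto
qed

text \<open>
  Fix the target \<open>j\<close> and look at the set of states from which \<open>j\<close> is reached in \<open>t\<close> steps with
  probability at least \<open>\<eta> ^ t\<close>. Moving the starting time backwards never removes a state, because
  a chain may stay where it is with probability above \<open>\<eta>\<close>. Over \<open>Q\<close> steps strong connectivity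
  gives an arc into the set from outside, so at least one state is added as long as one is
  missing. The set starts as \<open>{j}\<close> and therefore is full after at most \<open>CARD('m) * Q\<close> steps.
\<close>
lemma trans_prod_uniformly_positive:
  fixes P :: "nat \<Rightarrow> real ^ 'm::finite ^ 'm"
  assumes "Q \<ge> 1" and sc: "\<And>k. strongly_connected (transition_graph P Q k)"
    and diag: "\<And>k i. P k $ i $ i > 0"
    and "\<eta> > 0" and low: "\<And>k i j. P k $ i $ j > 0 \<Longrightarrow> P k $ i $ j > \<eta>"
    and ds: "\<And>k. doubly_stochastic (P k)"
  shows "trans_prod P n (CARD('m) * Q) $ i $ j \<ge> \<eta> ^ (CARD('m) * Q)"
proof -
  define S where "S n t = {i. trans_prod P n t $ i $ j \<ge> \<eta> ^ t}" for n t
  have dsU: "doubly_stochastic (trans_prod P n t)" for n t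
    by (rule doubly_stochastic_trans_prod[OF ds])
  have step_back: "u \<in> S l (Suc t)" if "P l $ u $ v > 0" "v \<in> S (Suc l) t" for u v l t
  proof -
    have "\<eta> * \<eta> ^ t \<le> P l $ u $ v * trans_prod P (Suc l) t $ v $ j"
      using that low[OF that(1)] \<open>\<eta> > 0\<close> by (intro mult_mono) (auto simp: S_def)
    also have "\<dots> \<le> (\<Sum>w\<in>UNIV. P l $ u $ w * trans_prod P (Suc l) t $ w $ j)"
      using ds dsU by (intro member_le_sum) (auto simp: doubly_stochastic_def)
    finally show ?thesis by (simp add: S_def matrix_matrix_mult_def)
  qed
  have stay_back: "S (n + q) t \<subseteq> S n (q + t)" for n q t
  proof (induction q arbitrary: n)
    case (Suc q)
    have "S (Suc n + q) t \<subseteq> S (Suc n) (q + t)" by (rule Suc.IH)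
    also have "\<dots> \<subseteq> S n (Suc (q + t))" using step_back diag by blast
    finally show ?case by simp
  qed simp
  have grow: "r + 1 \<le> CARD('m) \<longrightarrow> card (S n (r * Q)) \<ge> r + 1" for r n
  proof (induction r arbitrary: n)
    case 0
    have "j \<in> S n 0" by (simp add: S_def mat_def)
    then have "card (S n 0) > 0" by (auto simp: card_gt_0_iff)
    then show ?case by simp
  next
    case (Suc r)
    show ?case
    proof
      assume m: "Suc r + 1 \<le> CARD('m)"
      let ?T = "S (n + Q) (r * Q)" and ?T' = "S n (Suc r * Q)"
      have cT: "card ?T \<ge> r + 1" using Suc.IH[of "n + Q"] m by simp
      have sub: "?T \<subseteq> ?T'" using stay_back[of n Q "r * Q"] by simp
      show "Suc r + 1 \<le> card ?T'"
      proof (cases "?T = UNIV")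
        case True
        then have "?T' = UNIV" using sub by blast
        then show ?thesis using m by simp
      next
        case False
        moreover have "?T \<noteq> {}" using cT by auto
        ultimately obtain l u v where l: "n \<le> l" "l < n + Q" "u \<notin> ?T" "v \<in> ?T" "P l $ u $ v > 0"
          using strongly_connected_edge_into[OF sc \<open>Q \<ge> 1\<close>] by metis
        have "v \<in> S (Suc l) ((n + Q - Suc l) + r * Q)"
          using stay_back[of "Suc l" "n + Q - Suc l" "r * Q"] l by auto
        then have "u \<in> S l (Suc ((n + Q - Suc l) + r * Q))" using step_back l by blast
        moreover have "S l t \<subseteq> S n ((l - n) + t)" for t
          using stay_back[of n "l - n" t] l by simp
        ultimately have "u \<in> S n ((l - n) + Suc ((n + Q - Suc l) + r * Q))" by blast
        moreover have "(l - n) + Suc ((n + Q - Suc l) + r * Q) = Suc r * Q" using l by simp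
        ultimately have "u \<in> ?T'" by simp
        then have "insert u ?T \<subseteq> ?T'" using sub by simp
        then have "card (insert u ?T) \<le> card ?T'" by (intro card_mono) auto
        then show ?thesis using l cT by simp
      qed
    qed
  qed
  let ?m = "CARD('m)"
  have m: "?m > 0" by simp
  have "card (S (n + Q) ((?m - 1) * Q)) \<ge> ?m" using grow[of "?m - 1" "n + Q"] m by simp
  then have "S (n + Q) ((?m - 1) * Q) = UNIV"
    by (intro card_seteq) auto
  moreover have "Q + (?m - 1) * Q = ?m * Q"
    using m by (metis Suc_diff_1 mult_Suc)
  ultimately have "S n (?m * Q) = UNIV"
    using stay_back[of n Q "(?m - 1) * Q"] by auto
  then show ?thesis by (auto simp: S_def)
qed

text \<open>
  Doeblin's contraction. Every row puts weight at least \<open>\<delta>\<close> on an index where \<open>z\<close> is minimal. This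
  keeps every average at least \<open>\<delta> * d\<close> below the upper bound \<open>d\<close> plus the minimum of \<open>z\<close>, while no
  average falls below that minimum.
\<close>
lemma stochastic_spread_contraction:
  fixes A :: "real ^ 'm::finite ^ 'm"
  assumes A: "\<And>i j. A $ i $ j \<ge> 0" "\<And>i. (\<Sum>k\<in>UNIV. A $ i $ k) = 1"
    and low: "\<And>i j. A $ i $ j \<ge> \<delta>" and "d \<ge> 0"
    and z: "\<And>i j. z i - z j \<le> d"
  shows "(\<Sum>k\<in>UNIV. A $ i $ k * z k) - (\<Sum>k\<in>UNIV. A $ j $ k * z k) \<le> (1 - \<delta>) * d"
proof -
  obtain i0 where i0: "\<And>k. z i0 \<le> z k"
    using arg_min_least[of UNIV _ z] by auto
  have "(\<Sum>k\<in>UNIV. A $ i $ k * z k) \<le> (\<Sum>k\<in>UNIV. A $ i $ k * (z i0 + d) - (if k = i0 then A $ i $ i0 * d else 0))"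
  proof (rule sum_mono)
    fix k
    have "A $ i $ k * z k \<le> A $ i $ k * (z i0 + d)"
      using z[of k i0] A(1)[of i k] by (intro mult_left_mono) auto
    then show "A $ i $ k * z k \<le> A $ i $ k * (z i0 + d) - (if k = i0 then A $ i $ i0 * d else 0)"
      by (auto simp: algebra_simps)
  qed
  also have "\<dots> = z i0 + d - A $ i $ i0 * d"
    by (simp add: sum_subtractf sum_distrib_right[symmetric] A)
  also have "\<dots> \<le> z i0 + (1 - \<delta>) * d"
    using mult_right_mono[OF low[of i i0] \<open>d \<ge> 0\<close>] by (simp add: algebra_simps)
  finally have up: "(\<Sum>k\<in>UNIV. A $ i $ k * z k) \<le> z i0 + (1 - \<delta>) * d" .
  have "z i0 = (\<Sum>k\<in>UNIV. A $ j $ k * z i0)"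
    by (simp add: sum_distrib_right[symmetric] A)
  also have "\<dots> \<le> (\<Sum>k\<in>UNIV. A $ j $ k * z k)"
    using i0 A by (intro sum_mono mult_left_mono) auto
  finally show ?thesis using up by simp
qed

text \<open>
  Each block of \<open>N\<close> steps contracts the spread within a column by a fixed factor. A column of a
  doubly stochastic matrix has mean \<open>1 / CARD('m)\<close>, so its spread bounds the distance of its entries
  from that value. The limit is the uniform distribution because the columns sum to one;
  row sums alone would give a limit depending on the chain.
\<close>
lemma trans_prod_mixing:
  fixes P :: "nat \<Rightarrow> real ^ 'm::finite ^ 'm"
  assumes "Q \<ge> 1" and sc: "\<And>k. strongly_connected (transition_graph P Q k)"
    and diag: "\<And>k i. P k $ i $ i > 0"
    and "\<eta> > 0" and low: "\<And>k i j. P k $ i $ j > 0 \<Longrightarrow> P k $ i $ j > \<eta>"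
    and ds: "\<And>k. doubly_stochastic (P k)"
  obtains C \<beta> where "0 \<le> C" "0 < \<beta>" "\<beta> < 1"
    "\<And>n t i j. \<bar>trans_prod P n t $ i $ j - 1 / real CARD('m)\<bar> \<le> C * \<beta> ^ t"
proof -
  let ?U = "trans_prod P" and ?m = "real CARD('m)"
  define N where "N = CARD('m) * Q"
  have N: "N \<ge> 1" using \<open>Q \<ge> 1\<close> by (simp add: N_def Suc_le_eq)
  have dsU: "doubly_stochastic (?U n t)" for n t
    by (rule doubly_stochastic_trans_prod[OF ds])
  have "\<eta> < 1"
    using low[OF diag, of 0 undefined] doubly_stochastic_entry_le_1[OF ds, of 0 undefined undefined] by simp
  define \<gamma> where "\<gamma> = 1 - \<eta> ^ N"
  have \<gamma>: "0 < \<gamma>" "\<gamma> < 1"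
    using \<open>\<eta> < 1\<close> \<open>\<eta> > 0\<close> N by (auto simp: \<gamma>_def power_less_one_iff)
  have spread: "?U n (r * N + t) $ i $ j - ?U n (r * N + t) $ i' $ j \<le> \<gamma> ^ r" for n r t i i' j
  proof (induction r arbitrary: n i i')
    case 0
    have "0 \<le> ?U n t $ i' $ j" using dsU[of n t] by (simp add: doubly_stochastic_def)
    then show ?case
      using doubly_stochastic_entry_le_1[OF dsU[of n t], of i j] by simp
  next
    case (Suc r)
    have eq: "?U n (Suc r * N + t) $ i $ j
        = (\<Sum>k\<in>UNIV. ?U n N $ i $ k * ?U (n + N) (r * N + t) $ k $ j)" for i
      using trans_prod_add[of P n N "r * N + t"] by (simp add: matrix_matrix_mult_def add.assoc)
    have "?U n (Suc r * N + t) $ i $ j - ?U n (Suc r * N + t) $ i' $ j \<le> (1 - \<eta> ^ N) * \<gamma> ^ r"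
      unfolding eq
    proof (rule stochastic_spread_contraction)
      show "\<eta> ^ N \<le> ?U n N $ i $ j" for i j
        unfolding N_def by (rule trans_prod_uniformly_positive[OF assms])
    qed (use Suc.IH \<gamma> dsU[of n N] in \<open>auto simp: doubly_stochastic_def\<close>)
    then show ?case by (simp add: \<gamma>_def)
  qed
  \<comment> \<open>The factor \<open>\<gamma>\<close> per block of length \<open>N\<close> becomes a factor \<open>\<beta>\<close> per step; the incomplete last block
      costs at most one factor \<open>1 / \<gamma>\<close>.\<close>
  define \<beta> where "\<beta> = root N \<gamma>"
  have \<beta>: "0 < \<beta>" "\<beta> < 1" "\<beta> ^ N = \<gamma>"
    using N \<gamma> by (auto simp: \<beta>_def)
  have dev: "\<bar>?U n t $ i $ j - 1 / ?m\<bar> \<le> \<gamma> ^ (t div N)" for n t i j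
  proof -
    have sp: "?U n t $ i $ j - ?U n t $ i' $ j \<le> \<gamma> ^ (t div N)" for i i'
      using spread[of n "t div N" "t mod N" i j i'] by simp
    have col: "(\<Sum>k\<in>UNIV. ?U n t $ k $ j) = 1"
      using dsU[of n t] by (simp add: doubly_stochastic_def)
    have "?m * (?U n t $ i $ j - 1 / ?m) = (\<Sum>k\<in>UNIV. ?U n t $ i $ j - ?U n t $ k $ j)"
      by (simp add: sum_subtractf col algebra_simps)
    also have "\<bar>\<dots>\<bar> \<le> (\<Sum>k\<in>UNIV. \<bar>?U n t $ i $ j - ?U n t $ k $ j\<bar>)" by (rule sum_abs)
    also have "\<dots> \<le> (\<Sum>k\<in>(UNIV::'m set). \<gamma> ^ (t div N))"
      using sp by (intro sum_mono) (auto simp: abs_le_iff)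
    finally have "?m * \<bar>?U n t $ i $ j - 1 / ?m\<bar> \<le> ?m * \<gamma> ^ (t div N)"
      by (simp add: abs_mult)
    then show ?thesis by simp
  qed
  have "\<gamma> ^ (t div N) \<le> (1 / \<gamma>) * \<beta> ^ t" for t
  proof -
    have "\<gamma> * \<gamma> ^ (t div N) = \<beta> ^ (N * Suc (t div N))"
      by (simp only: power_mult \<beta> power_Suc)
    also have "\<dots> \<le> \<beta> ^ t"
      using \<beta> N dividend_less_times_div[of N t] by (intro power_decreasing) auto
    finally show ?thesis using \<gamma> by (simp add: field_simps)
  qed
  then have "\<bar>?U n t $ i $ j - 1 / ?m\<bar> \<le> (1 / \<gamma>) * \<beta> ^ t" for n t i j
    using dev order_trans by blast
  then show thesis using that[of "1 / \<gamma>" \<beta>] \<beta> \<gamma> by simp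
qed

section \<open>Bias of Markov sampling\<close>

lemma (in prob_space) integrable_real_bounded:
  fixes h :: "'a \<Rightarrow> real"
  assumes "h \<in> borel_measurable M" "\<And>\<omega>. \<omega> \<in> space M \<Longrightarrow> \<bar>h \<omega>\<bar> \<le> K"
  shows "integrable M h"
  using assms by (intro integrable_const_bound[where B = K]) auto

text \<open>
  Conditioning on \<open>G\<close> replaces the indicator of each next state by its transition probability.
\<close>
lemma (in prob_space) expectation_next_state:
  fixes s' :: "'a \<Rightarrow> 'm::finite" and p :: "'m \<Rightarrow> 'a \<Rightarrow> real" and h :: "'m \<Rightarrow> 'a \<Rightarrow> real"
  assumes sub: "subalgebra M G"
    and s: "s' \<in> M \<rightarrow>\<^sub>M count_space UNIV"
    and markov: "\<And>j. AE \<omega> in M. real_cond_exp M G (indicator {\<omega>' \<in> space M. s' \<omega>' = j}) \<omega> = p j \<omega>"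
    and p: "\<And>j. p j \<in> borel_measurable M"
    and h: "\<And>j. h j \<in> borel_measurable G" "\<And>j \<omega>. \<omega> \<in> space M \<Longrightarrow> \<bar>h j \<omega>\<bar> \<le> K"
  shows "expectation (\<lambda>\<omega>. h (s' \<omega>) \<omega>) = expectation (\<lambda>\<omega>. \<Sum>j\<in>UNIV. p j \<omega> * h j \<omega>)"
proof -
  interpret finite_measure_subalgebra M G by unfold_locales (rule sub)
  let ?I = "\<lambda>j. indicator {\<omega>' \<in> space M. s' \<omega>' = j} :: 'a \<Rightarrow> real"
  have hM [measurable]: "h j \<in> borel_measurable M" for j
    by (rule measurable_from_subalg[OF sub h(1)])
  note s [measurable] p [measurable]
  have I [measurable]: "?I j \<in> borel_measurable M" for j by measurable
  have int: "integrable M (\<lambda>\<omega>. h j \<omega> * ?I j \<omega>)" for j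
  proof (rule integrable_real_bounded)
    show "\<bar>h j \<omega> * ?I j \<omega>\<bar> \<le> K" if "\<omega> \<in> space M" for \<omega>
      using h(2)[OF that, of j] by (auto simp: indicator_def abs_mult)
  qed measurable
  have ae: "AE \<omega> in M. h j \<omega> * real_cond_exp M G (?I j) \<omega> = p j \<omega> * h j \<omega>" for j
    using markov[of j] by eventually_elim simp
  have [measurable]: "real_cond_exp M G (?I j) \<in> borel_measurable M" for j by simp
  have intp: "integrable M (\<lambda>\<omega>. p j \<omega> * h j \<omega>)" for j
  proof -
    have "integrable M (\<lambda>\<omega>. h j \<omega> * real_cond_exp M G (?I j) \<omega>)"
      by (rule real_cond_exp_intg(1)[OF int h(1) I])
    then show ?thesis
      using ae by (subst (asm) integrable_cong_AE) auto
  qed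
  have "expectation (\<lambda>\<omega>. h (s' \<omega>) \<omega>) = expectation (\<lambda>\<omega>. \<Sum>j\<in>UNIV. h j \<omega> * ?I j \<omega>)"
    by (intro Bochner_Integration.integral_cong) (auto simp: indicator_def)
  also have "\<dots> = (\<Sum>j\<in>UNIV. expectation (\<lambda>\<omega>. h j \<omega> * real_cond_exp M G (?I j) \<omega>))"
    by (subst Bochner_Integration.integral_sum) (auto intro!: int sum.cong real_cond_exp_intg(2)[symmetric] h)
  also have "\<dots> = (\<Sum>j\<in>UNIV. expectation (\<lambda>\<omega>. p j \<omega> * h j \<omega>))"
    using ae by (intro sum.cong integral_cong_AE) auto
  also have "\<dots> = expectation (\<lambda>\<omega>. \<Sum>j\<in>UNIV. p j \<omega> * h j \<omega>)"
    by (subst Bochner_Integration.integral_sum) (auto intro: intp)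
  finally show ?thesis .
qed

text \<open>
  Let \<open>W n t i y\<close> be the bias, relative to uniform sampling, of an observation made \<open>t\<close> steps after
  time \<open>n\<close>, from state \<open>i\<close>, if the point were frozen at \<open>y\<close>; mixing makes it of order \<open>\<rho> t\<close>. By the
  Markov property its expectation along the chain is unchanged when the chain takes one step, leaving
  one step less to the observation, and the point stays. Letting the point move as well costs \<open>\<rho> t\<close>
  times the length of the move, since \<open>W n t i\<close> is Lipschitz with a modulus of that order. Going
  from time \<open>k\<close> back to time \<open>0\<close> in this way collects a convolution of \<open>\<rho>\<close> with the lengths of the
  steps.
\<close>
lemma (in prob_space) markov_sampling_bias:
  fixes s :: "nat \<Rightarrow> 'a \<Rightarrow> 'm::finite" and x :: "nat \<Rightarrow> 'a \<Rightarrow> 'b::euclidean_space"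
    and g :: "'m \<Rightarrow> 'b \<Rightarrow> real" and P :: "nat \<Rightarrow> real ^ 'm ^ 'm"
  assumes sub: "\<And>k. subalgebra M (G k)"
    and s_adapted: "\<And>k. s k \<in> G k \<rightarrow>\<^sub>M count_space UNIV"
    and x_adapted: "\<And>k. x k \<in> borel_measurable (G k)"
    and x_in: "\<And>k \<omega>. \<omega> \<in> space M \<Longrightarrow> x k \<omega> \<in> X"
    and markov: "\<And>k j. AE \<omega> in M.
          real_cond_exp M (G k) (indicator {\<omega>' \<in> space M. s (k + 1) \<omega>' = j}) \<omega> = P k $ s k \<omega> $ j"
    and ds: "\<And>k. doubly_stochastic (P k)"
    and mix: "\<And>n t i j. \<bar>trans_prod P n t $ i $ j - 1 / real CARD('m)\<bar> \<le> \<rho> t"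
    and g_cont: "\<And>j. continuous_on UNIV (g j)"
    and g_bound: "\<And>j y. y \<in> X \<Longrightarrow> \<bar>g j y\<bar> \<le> B"
    and g_lip: "\<And>j y z. y \<in> X \<Longrightarrow> z \<in> X \<Longrightarrow> \<bar>g j y - g j z\<bar> \<le> L * norm (y - z)"
    and "L \<ge> 0"
    and drift: "\<And>k. integrable M (\<lambda>\<omega>. norm (x (k + 1) \<omega> - x k \<omega>))"
      "\<And>k. expectation (\<lambda>\<omega>. norm (x (k + 1) \<omega> - x k \<omega>)) \<le> c k"
  shows "\<bar>expectation (\<lambda>\<omega>. g (s (k + 1) \<omega>) (x k \<omega>))
           - expectation (\<lambda>\<omega>. \<Sum>j\<in>UNIV. g j (x k \<omega>)) / real CARD('m)\<bar>
         \<le> real CARD('m) * (B * \<rho> (k + 1) + L * (\<Sum>l<k. \<rho> (k - l) * c l))"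
proof -
  let ?m = "real CARD('m)"
  have sM [measurable]: "s k \<in> M \<rightarrow>\<^sub>M count_space UNIV" for k
    by (rule measurable_from_subalg[OF sub s_adapted])
  have xM [measurable]: "x k \<in> borel_measurable M" for k
    by (rule measurable_from_subalg[OF sub x_adapted])
  have g_meas [measurable]: "g j \<in> borel_measurable borel" for j
    by (rule borel_measurable_continuous_onI[OF g_cont])
  have \<rho>: "0 \<le> \<rho> t" for t
    using mix[of undefined t undefined undefined] by linarith
  define W where "W n t i y = (\<Sum>j\<in>UNIV. (trans_prod P n t $ i $ j - 1 / ?m) * g j y)" for n t i y
  have W_meas [measurable]: "W n t i \<in> borel_measurable borel" for n t i
    unfolding W_def by measurable
  have W_bound: "\<bar>W n t i y\<bar> \<le> ?m * (\<rho> t * B)" if "y \<in> X" for n t i y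
  proof -
    have "\<bar>W n t i y\<bar> \<le> (\<Sum>j\<in>(UNIV::'m set). \<rho> t * B)"
      unfolding W_def using mix g_bound[OF that] \<rho>
      by (intro order.trans[OF sum_abs] sum_mono) (auto simp: abs_mult intro!: mult_mono)
    then show ?thesis by simp
  qed
  have W_lip: "\<bar>W n t i y - W n t i z\<bar> \<le> ?m * (\<rho> t * (L * norm (y - z)))" if "y \<in> X" "z \<in> X" for n t i y z
  proof -
    have "W n t i y - W n t i z = (\<Sum>j\<in>UNIV. (trans_prod P n t $ i $ j - 1 / ?m) * (g j y - g j z))"
      by (simp add: W_def right_diff_distrib sum_subtractf)
    also have "\<bar>\<dots>\<bar> \<le> (\<Sum>j\<in>(UNIV::'m set). \<rho> t * (L * norm (y - z)))"
      using mix g_lip[OF that] \<rho>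
      by (intro order.trans[OF sum_abs] sum_mono) (auto simp: abs_mult intro!: mult_mono)
    finally show ?thesis by simp
  qed
  have W_step: "(\<Sum>i\<in>UNIV. P n $ a $ i * W (Suc n) t i y) = W n (Suc t) a y" for n t a y
  proof -
    have row: "(\<Sum>i\<in>UNIV. P n $ a $ i) = 1" using ds[of n] by (simp add: doubly_stochastic_def)
    have "(\<Sum>i\<in>UNIV. P n $ a $ i * W (Suc n) t i y)
        = (\<Sum>j\<in>UNIV. \<Sum>i\<in>UNIV. P n $ a $ i * ((trans_prod P (Suc n) t $ i $ j - 1 / ?m) * g j y))"
      unfolding W_def sum_distrib_left by (rule sum.swap)
    also have "\<dots> = (\<Sum>j\<in>UNIV. ((\<Sum>i\<in>UNIV. P n $ a $ i * trans_prod P (Suc n) t $ i $ j)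
                          - (\<Sum>i\<in>UNIV. P n $ a $ i) / ?m) * g j y)"
      by (intro sum.cong refl)
         (simp add: algebra_simps sum_subtractf sum_distrib_left sum_divide_distrib)
    also have "\<dots> = W n (Suc t) a y"
      by (simp add: W_def row matrix_matrix_mult_def)
    finally show ?thesis .
  qed
  have W_int: "integrable M (\<lambda>\<omega>. W n t (s k \<omega>) (x l \<omega>))" for n t k l
  proof (rule integrable_real_bounded)
    show "\<bar>W n t (s k \<omega>) (x l \<omega>)\<bar> \<le> ?m * (\<rho> t * B)" if "\<omega> \<in> space M" for \<omega>
      using W_bound x_in[OF that] by blast
  qed measurable
  have W_next: "expectation (\<lambda>\<omega>. W (Suc n) t (s (Suc n) \<omega>) (x n \<omega>))
      = expectation (\<lambda>\<omega>. W n (Suc t) (s n \<omega>) (x n \<omega>))" for n t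
  proof -
    note x_adapted [measurable]
    have "expectation (\<lambda>\<omega>. W (Suc n) t (s (Suc n) \<omega>) (x n \<omega>))
        = expectation (\<lambda>\<omega>. \<Sum>i\<in>UNIV. P n $ s n \<omega> $ i * W (Suc n) t i (x n \<omega>))"
    proof (rule expectation_next_state[OF sub[of n]])
      show "AE \<omega> in M. real_cond_exp M (G n) (indicator {\<omega>' \<in> space M. s (Suc n) \<omega>' = j}) \<omega>
              = P n $ s n \<omega> $ j" for j
        using markov[of n j] by simp
      show "\<bar>W (Suc n) t j (x n \<omega>)\<bar> \<le> ?m * (\<rho> t * B)" if "\<omega> \<in> space M" for j \<omega>
        using W_bound x_in[OF that] by blast
    qed measurable
    then show ?thesis by (simp add: W_step)
  qed
  have bias: "\<bar>expectation (\<lambda>\<omega>. W n t (s n \<omega>) (x n \<omega>))\<bar>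
      \<le> ?m * (B * \<rho> (n + t) + L * (\<Sum>l<n. \<rho> (n + t - 1 - l) * c l))" for n t
  proof (induction n arbitrary: t)
    case 0
    have "\<bar>expectation (\<lambda>\<omega>. W 0 t (s 0 \<omega>) (x 0 \<omega>))\<bar> \<le> expectation (\<lambda>\<omega>. \<bar>W 0 t (s 0 \<omega>) (x 0 \<omega>)\<bar>)"
      by (rule integral_abs_bound)
    also have "\<dots> \<le> expectation (\<lambda>\<omega>. ?m * (\<rho> t * B))"
      using W_bound x_in W_int by (intro integral_mono) auto
    finally show ?case by (simp add: prob_space algebra_simps)
  next
    case (Suc n)
    let ?D = "\<lambda>\<omega>. W (Suc n) t (s (Suc n) \<omega>) (x (Suc n) \<omega>) - W (Suc n) t (s (Suc n) \<omega>) (x n \<omega>)"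
    have "\<bar>expectation ?D\<bar> \<le> expectation (\<lambda>\<omega>. \<bar>?D \<omega>\<bar>)"
      by (rule integral_abs_bound)
    also have "\<dots> \<le> expectation (\<lambda>\<omega>. ?m * (\<rho> t * (L * norm (x (Suc n) \<omega> - x n \<omega>))))"
      using W_lip x_in W_int drift(1)[of n] by (intro integral_mono) auto
    also have "\<dots> \<le> ?m * (\<rho> t * (L * c n))"
      using drift(2)[of n] \<rho> \<open>L \<ge> 0\<close> by (auto intro!: mult_left_mono)
    finally have "\<bar>expectation ?D\<bar> \<le> ?m * (\<rho> t * (L * c n))" .
    moreover have "expectation (\<lambda>\<omega>. W (Suc n) t (s (Suc n) \<omega>) (x (Suc n) \<omega>))
        = expectation ?D + expectation (\<lambda>\<omega>. W n (Suc t) (s n \<omega>) (x n \<omega>))"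
      by (simp add: W_int flip: W_next)
    ultimately have "\<bar>expectation (\<lambda>\<omega>. W (Suc n) t (s (Suc n) \<omega>) (x (Suc n) \<omega>))\<bar>
        \<le> ?m * (\<rho> t * (L * c n)) + ?m * (B * \<rho> (n + Suc t) + L * (\<Sum>l<n. \<rho> (n + Suc t - 1 - l) * c l))"
      using Suc.IH[of "Suc t"] by linarith
    then show ?case by (simp add: algebra_simps)
  qed
  have g_int: "integrable M (\<lambda>\<omega>. g (s n \<omega>) (x k \<omega>))" "integrable M (\<lambda>\<omega>. g j (x k \<omega>))" for n j
    using g_bound x_in by (auto intro!: integrable_real_bounded[where K = B])
  \<comment> \<open>With no step left to take, \<open>W\<close> is the deviation of a component from the average.\<close>
  have W0: "W (Suc k) 0 i y = g i y - (\<Sum>j\<in>UNIV. g j y) / ?m" for i y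
  proof -
    have "W (Suc k) 0 i y = (\<Sum>j\<in>UNIV. (if j = i then g j y else 0) - g j y / ?m)"
      unfolding W_def by (intro sum.cong) (auto simp: mat_def algebra_simps)
    then show ?thesis by (simp add: sum_subtractf sum_divide_distrib)
  qed
  have "expectation (\<lambda>\<omega>. W k 1 (s k \<omega>) (x k \<omega>))
      = expectation (\<lambda>\<omega>. g (s (k + 1) \<omega>) (x k \<omega>) - (\<Sum>j\<in>UNIV. g j (x k \<omega>)) / ?m)"
    using W_next[of k 0] by (simp add: W0)
  also have "\<dots> = expectation (\<lambda>\<omega>. g (s (k + 1) \<omega>) (x k \<omega>))
       - expectation (\<lambda>\<omega>. \<Sum>j\<in>UNIV. g j (x k \<omega>)) / ?m"
    using g_int by simp
  finally show ?thesis using bias[of k 1] by simp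
qed

section \<open>Projected subgradient steps\<close>

text \<open>
  A convex function is bounded on the unit neighbourhood of \<open>X\<close>, hence rises by a bounded amount
  along any unit segment that starts in \<open>X\<close>. This limits subgradients, whose inner product with a
  direction is at most the rise along it, and by convexity it limits slopes between points of \<open>X\<close>.
\<close>
lemma convex_bounded_subgradient_lipschitz:
  fixes f :: "'b::euclidean_space \<Rightarrow> real"
  assumes "convex_on UNIV f" "bounded X"
  obtains L where "L \<ge> 0"
    "\<And>x v. x \<in> X \<Longrightarrow> is_subgradient f x v \<Longrightarrow> norm v \<le> L"
    "\<And>x y. x \<in> X \<Longrightarrow> y \<in> X \<Longrightarrow> \<bar>f x - f y\<bar> \<le> L * norm (x - y)"
proof -
  obtain r where r: "\<And>x. x \<in> X \<Longrightarrow> norm x \<le> r"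
    using \<open>bounded X\<close> by (auto simp: bounded_iff)
  have "continuous_on (cball 0 (r + 1)) f"
    using convex_on_continuous[OF open_UNIV assms(1)] continuous_on_subset by blast
  then have "bounded (f ` cball 0 (r + 1))"
    using compact_imp_bounded compact_continuous_image compact_cball by blast
  then obtain B where "\<forall>z\<in>cball 0 (r + 1). \<bar>f z\<bar> \<le> B"
    by (auto simp: bounded_iff)
  then have B: "\<bar>f z\<bar> \<le> B" if "norm z \<le> r + 1" for z
    using that by auto
  have rise: "f (x + u) - f z \<le> 2 * \<bar>B\<bar>" if "x \<in> X" "z \<in> X" "norm u \<le> 1" for x z u
    using B[of "x + u"] B[of z] r[OF that(1)] r[OF that(2)] norm_triangle_ineq[of x u] that(3) by auto
  have sub: "norm v \<le> 2 * \<bar>B\<bar>" if x: "x \<in> X" and v: "is_subgradient f x v" for x v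
  proof (cases "v = 0")
    case False
    have "norm v = v \<bullet> sgn v"
      using False by (simp add: sgn_div_norm dot_square_norm power2_eq_square)
    also have "\<dots> \<le> f (x + sgn v) - f x"
      using v by (auto simp: is_subgradient_def dest: spec[of _ "x + sgn v"])
    also have "\<dots> \<le> 2 * \<bar>B\<bar>" by (rule rise[OF x x]) (simp add: norm_sgn)
    finally show ?thesis .
  qed simp
  have lip1: "f y - f x \<le> 2 * \<bar>B\<bar> * norm (x - y)" if x: "x \<in> X" and y: "y \<in> X" for x y
  proof (cases "x = y")
    case False
    define t w where "t = norm (y - x)" and "w = y + sgn (y - x)"
    have t: "t > 0" using False by (simp add: t_def)
    \<comment> \<open>\<open>w\<close> prolongs the segment from \<open>x\<close> to \<open>y\<close> by a unit, so \<open>y\<close> is a convex combination of both ends.\<close>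
    have "(1 + t) *\<^sub>R y = x + t *\<^sub>R w"
      using t by (simp add: w_def t_def sgn_div_norm algebra_simps)
    then have "(1 / (1 + t)) *\<^sub>R ((1 + t) *\<^sub>R y) = (1 / (1 + t)) *\<^sub>R (x + t *\<^sub>R w)"
      by (rule arg_cong)
    then have "y = (1 / (1 + t)) *\<^sub>R x + (t / (1 + t)) *\<^sub>R w"
      using t by (simp add: scaleR_right_distrib)
    moreover have "1 / (1 + t) = 1 - t / (1 + t)"
      using t by (simp add: field_simps)
    ultimately have "y = (1 - t / (1 + t)) *\<^sub>R x + (t / (1 + t)) *\<^sub>R w"
      by simp
    then have "f y \<le> (1 - t / (1 + t)) * f x + (t / (1 + t)) * f w"
      using t convex_onD[OF assms(1), of "t / (1 + t)" x w] by simp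
    also have "\<dots> = f x + (t / (1 + t)) * (f w - f x)"
      by (simp only: left_diff_distrib right_diff_distrib)
    also have "\<dots> \<le> f x + (t / (1 + t)) * (2 * \<bar>B\<bar>)"
      using rise[OF y x, of "sgn (y - x)"] t by (intro add_left_mono mult_left_mono) (auto simp: w_def norm_sgn)
    also have "\<dots> \<le> f x + t * (2 * \<bar>B\<bar>)"
      using t by (intro add_left_mono mult_right_mono) (auto simp: field_simps)
    finally show ?thesis by (simp add: t_def norm_minus_commute mult.commute)
  qed simp
  show thesis
  proof (rule that[of "2 * \<bar>B\<bar>"])
    show "\<bar>f x - f y\<bar> \<le> 2 * \<bar>B\<bar> * norm (x - y)" if "x \<in> X" "y \<in> X" for x y
      using lip1[OF that] lip1[OF that(2,1)] by (simp add: norm_minus_commute abs_le_iff)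
  qed (use sub in auto)
qed

text \<open>
  The point \<open>y\<close> is its own projection, so the projection, being nonexpansive, brings no point further
  away from it.
\<close>
lemma projected_step:
  fixes X :: "'b::euclidean_space set"
  assumes X: "X \<noteq> {}" "closed X" "convex X" and "y \<in> X"
  shows "(norm (closest_point X (x - \<alpha> *\<^sub>R v) - y))\<^sup>2
       \<le> (norm (x - y))\<^sup>2 - 2 * \<alpha> * (v \<bullet> (x - y)) + \<alpha>\<^sup>2 * (norm v)\<^sup>2"
proof -
  have "norm (closest_point X (x - \<alpha> *\<^sub>R v) - y) \<le> norm ((x - y) - \<alpha> *\<^sub>R v)"
    using closest_point_lipschitz[OF X(3,2,1), of "x - \<alpha> *\<^sub>R v" y] closest_point_self[OF \<open>y \<in> X\<close>]
    by (simp add: dist_norm algebra_simps)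
  then have "(norm (closest_point X (x - \<alpha> *\<^sub>R v) - y))\<^sup>2 \<le> (norm ((x - y) - \<alpha> *\<^sub>R v))\<^sup>2"
    by (intro power_mono) auto
  also have "\<dots> = (norm (x - y))\<^sup>2 - 2 * \<alpha> * (v \<bullet> (x - y)) + \<alpha>\<^sup>2 * (norm v)\<^sup>2"
    unfolding power2_norm_eq_inner
    by (simp add: inner_diff_left inner_diff_right inner_commute power2_eq_square algebra_simps)
  finally show ?thesis .
qed

lemma (in prob_space) expected_projected_step:
  fixes X :: "'b::euclidean_space set"
  assumes X: "X \<noteq> {}" "closed X" "convex X" and "y \<in> X" and "\<alpha> \<ge> 0"
    and step: "\<And>\<omega>. \<omega> \<in> space M \<Longrightarrow> x' \<omega> = closest_point X (x \<omega> - \<alpha> *\<^sub>R (d \<omega> + e \<omega>))"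
    and gap: "\<And>\<omega>. \<omega> \<in> space M \<Longrightarrow> gap \<omega> \<le> d \<omega> \<bullet> (x \<omega> - y)"
    and d: "\<And>\<omega>. \<omega> \<in> space M \<Longrightarrow> norm (d \<omega>) \<le> L"
    and int: "integrable M gap" "integrable M (\<lambda>\<omega>. (norm (x \<omega> - y))\<^sup>2)"
      "integrable M (\<lambda>\<omega>. (norm (x' \<omega> - y))\<^sup>2)" "integrable M (\<lambda>\<omega>. e \<omega> \<bullet> (x \<omega> - y))"
      "integrable M (\<lambda>\<omega>. (norm (e \<omega>))\<^sup>2)"
  shows "expectation (\<lambda>\<omega>. (norm (x' \<omega> - y))\<^sup>2)
       \<le> expectation (\<lambda>\<omega>. (norm (x \<omega> - y))\<^sup>2) - 2 * \<alpha> * expectation gap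
         - 2 * \<alpha> * expectation (\<lambda>\<omega>. e \<omega> \<bullet> (x \<omega> - y))
         + \<alpha>\<^sup>2 * (2 * L\<^sup>2 + 2 * expectation (\<lambda>\<omega>. (norm (e \<omega>))\<^sup>2))"
proof -
  let ?R = "\<lambda>\<omega>. (norm (x \<omega> - y))\<^sup>2 - 2 * \<alpha> * gap \<omega> - 2 * \<alpha> * (e \<omega> \<bullet> (x \<omega> - y))
       + \<alpha>\<^sup>2 * (2 * L\<^sup>2 + 2 * (norm (e \<omega>))\<^sup>2)"
  have "expectation (\<lambda>\<omega>. (norm (x' \<omega> - y))\<^sup>2) \<le> expectation ?R"
  proof (rule integral_mono)
    show "integrable M ?R" using int by auto
    fix \<omega> assume \<omega>: "\<omega> \<in> space M"
    have sq: "(norm (d \<omega> + e \<omega>))\<^sup>2 \<le> 2 * L\<^sup>2 + 2 * (norm (e \<omega>))\<^sup>2"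
    proof -
      have "(norm (d \<omega> + e \<omega>))\<^sup>2 \<le> (L + norm (e \<omega>))\<^sup>2"
        using norm_triangle_ineq[of "d \<omega>" "e \<omega>"] d[OF \<omega>] by (intro power_mono) auto
      also have "\<dots> \<le> 2 * L\<^sup>2 + 2 * (norm (e \<omega>))\<^sup>2"
        using zero_le_power2[of "L - norm (e \<omega>)"] by (simp add: power2_eq_square algebra_simps)
      finally show ?thesis .
    qed
    have "(norm (x' \<omega> - y))\<^sup>2 \<le> (norm (x \<omega> - y))\<^sup>2 - 2 * \<alpha> * ((d \<omega> + e \<omega>) \<bullet> (x \<omega> - y))
        + \<alpha>\<^sup>2 * (norm (d \<omega> + e \<omega>))\<^sup>2"
      unfolding step[OF \<omega>] by (rule projected_step[OF X \<open>y \<in> X\<close>])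
    also have "\<dots> \<le> ?R \<omega>"
      using mult_left_mono[OF gap[OF \<omega>], of "2 * \<alpha>"] mult_left_mono[OF sq, of "\<alpha>\<^sup>2"] \<open>\<alpha> \<ge> 0\<close>
      by (simp add: inner_add_left algebra_simps)
    finally show "(norm (x' \<omega> - y))\<^sup>2 \<le> ?R \<omega>" .
  qed (rule int)
  also have "expectation ?R = expectation (\<lambda>\<omega>. (norm (x \<omega> - y))\<^sup>2) - 2 * \<alpha> * expectation gap
         - 2 * \<alpha> * expectation (\<lambda>\<omega>. e \<omega> \<bullet> (x \<omega> - y))
         + \<alpha>\<^sup>2 * (2 * L\<^sup>2 + 2 * expectation (\<lambda>\<omega>. (norm (e \<omega>))\<^sup>2))"
    using int by (simp add: prob_space)
  finally show ?thesis .
qed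

section \<open>Conditional moments of the noise and the history\<close>

lemma sets_history:
  "sets (history M x0 s e k) = sigma_sets (space M)
     ({x0 -` A \<inter> space M | A. A \<in> sets borel} \<union>
      {s n -` B \<inter> space M | n B. n \<le> k} \<union>
      {e n -` A \<inter> space M | n A. 1 \<le> n \<and> n \<le> k \<and> A \<in> sets borel})"
  unfolding history_def by (rule sets_measure_of) auto

lemma space_history: "space (history M x0 s e k) = space M"
  by (simp add: history_def space_measure_of_conv)

lemma subalgebra_history:
  assumes x0: "x0 \<in> borel_measurable M" and s: "\<And>k. s k \<in> M \<rightarrow>\<^sub>M count_space UNIV"
    and e: "\<And>n. n \<ge> 1 \<Longrightarrow> e n \<in> borel_measurable M"
  shows "subalgebra M (history M x0 s e k)"
proof -
  have "s n -` B \<inter> space M \<in> sets M" for n B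
    by (rule measurable_sets[OF s]) simp
  then have "{s n -` B \<inter> space M | n B. n \<le> k} \<subseteq> sets M" by blast
  moreover have "{x0 -` A \<inter> space M | A. A \<in> sets borel} \<subseteq> sets M"
    using measurable_sets[OF x0] by blast
  moreover have "{e n -` A \<inter> space M | n A. 1 \<le> n \<and> n \<le> k \<and> A \<in> sets borel} \<subseteq> sets M"
    using measurable_sets[OF e] by blast
  ultimately have "sets (history M x0 s e k) \<subseteq> sets M"
    unfolding sets_history by (intro sets.sigma_sets_subset Un_least)
  then show ?thesis by (simp add: subalgebra_def space_history)
qed

lemma measurable_history_state:
  "s k \<in> history M x0 s e k \<rightarrow>\<^sub>M count_space UNIV"
proof (rule measurableI)
  fix B
  have "s k -` B \<inter> space M \<in> {s n -` B \<inter> space M | n B. n \<le> k}" by blast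
  then have "s k -` B \<inter> space M \<in> sets (history M x0 s e k)"
    unfolding sets_history by (intro sigma_sets.Basic UnI1 UnI2)
  then show "s k -` B \<inter> space (history M x0 s e k) \<in> sets (history M x0 s e k)"
    by (simp add: space_history)
qed simp

lemma (in prob_space) conditional_second_moment_bound:
  assumes sub: "subalgebra M G" and e [measurable]: "e \<in> borel_measurable M"
    and bound: "AE \<omega> in M. nn_cond_exp M G (\<lambda>\<omega>'. ennreal ((norm (e \<omega>'))\<^sup>2)) \<omega> \<le> ennreal (\<nu>\<^sup>2)"
  shows "integrable M (\<lambda>\<omega>. (norm (e \<omega>))\<^sup>2)" "expectation (\<lambda>\<omega>. (norm (e \<omega>))\<^sup>2) \<le> \<nu>\<^sup>2"
proof -
  interpret finite_measure_subalgebra M G by unfold_locales (rule sub)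
  have "(\<integral>\<^sup>+\<omega>. ennreal ((norm (e \<omega>))\<^sup>2) \<partial>M)
      = (\<integral>\<^sup>+\<omega>. nn_cond_exp M G (\<lambda>\<omega>'. ennreal ((norm (e \<omega>'))\<^sup>2)) \<omega> \<partial>M)"
    using nn_cond_exp_intg[of "\<lambda>_. 1" "\<lambda>\<omega>'. ennreal ((norm (e \<omega>'))\<^sup>2)"] by simp
  also have "\<dots> \<le> (\<integral>\<^sup>+\<omega>. ennreal (\<nu>\<^sup>2) \<partial>M)"
    by (rule nn_integral_mono_AE[OF bound])
  finally have le: "(\<integral>\<^sup>+\<omega>. ennreal ((norm (e \<omega>))\<^sup>2) \<partial>M) \<le> ennreal (\<nu>\<^sup>2)"
    by (simp add: emeasure_space_1)
  show int: "integrable M (\<lambda>\<omega>. (norm (e \<omega>))\<^sup>2)"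
    using le by (intro integrableI_bounded) (auto simp: less_top[symmetric] top_unique)
  show "expectation (\<lambda>\<omega>. (norm (e \<omega>))\<^sup>2) \<le> \<nu>\<^sup>2"
    using le nn_integral_eq_integral[OF int] by (simp add: ennreal_le_iff)
qed

text \<open>
  As \<open>z\<close> is \<open>G\<close>-measurable, \<open>e\<close> may be replaced by its conditional expectation, componentwise; the
  Cauchy-Schwarz inequality does the rest.
\<close>
lemma (in prob_space) conditional_mean_inner_bound:
  fixes e z :: "'a \<Rightarrow> real ^ 'n"
  assumes sub: "subalgebra M G" and e: "integrable M e"
    and z [measurable]: "z \<in> borel_measurable G" and z_bound: "\<And>\<omega>. \<omega> \<in> space M \<Longrightarrow> norm (z \<omega>) \<le> D"
    and bound: "AE \<omega> in M. norm (vec_cond_exp M G e \<omega>) \<le> \<mu>"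
  shows "integrable M (\<lambda>\<omega>. e \<omega> \<bullet> z \<omega>)" "\<bar>expectation (\<lambda>\<omega>. e \<omega> \<bullet> z \<omega>)\<bar> \<le> \<mu> * D"
proof -
  interpret finite_measure_subalgebra M G by unfold_locales (rule sub)
  let ?c = "\<lambda>i. real_cond_exp M G (\<lambda>\<omega>. e \<omega> $ i)"
  have eM [measurable]: "e \<in> borel_measurable M" using e by auto
  have zM [measurable]: "z \<in> borel_measurable M" by (rule measurable_from_subalg[OF sub z])
  have comp_meas: "(\<lambda>v::real^'n. v $ i) \<in> borel_measurable borel" for i
    by (intro borel_measurable_continuous_onI continuous_intros)
  note [measurable] = measurable_compose[OF eM comp_meas] measurable_compose[OF zM comp_meas]
  have zG: "(\<lambda>\<omega>. z \<omega> $ i) \<in> borel_measurable G" for i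
    by (rule measurable_compose[OF z comp_meas])
  have int: "integrable M (\<lambda>\<omega>. z \<omega> $ i * e \<omega> $ i)" for i
  proof (rule Bochner_Integration.integrable_bound)
    show "integrable M (\<lambda>\<omega>. D * norm (e \<omega>))" using e by simp
    show "AE \<omega> in M. norm (z \<omega> $ i * e \<omega> $ i) \<le> norm (D * norm (e \<omega>))"
    proof (rule AE_I2)
      fix \<omega> assume \<omega>: "\<omega> \<in> space M"
      have "\<bar>z \<omega> $ i\<bar> \<le> D" using component_le_norm_cart[of "z \<omega>" i] z_bound[OF \<omega>] by simp
      then show "norm (z \<omega> $ i * e \<omega> $ i) \<le> norm (D * norm (e \<omega>))"
        using component_le_norm_cart[of "e \<omega>" i] by (auto simp: abs_mult intro!: mult_mono)
    qed
  qed measurable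
  note ce = real_cond_exp_intg[OF int zG measurable_compose[OF eM comp_meas]]
  have inner: "v \<bullet> w = (\<Sum>i\<in>UNIV. w $ i * v $ i)" for v w :: "real ^ 'n"
    by (simp add: inner_vec_def mult.commute)
  show "integrable M (\<lambda>\<omega>. e \<omega> \<bullet> z \<omega>)"
    unfolding inner by (intro Bochner_Integration.integrable_sum int)
  have int': "integrable M (\<lambda>\<omega>. vec_cond_exp M G e \<omega> \<bullet> z \<omega>)"
    unfolding inner vec_cond_exp_def vec_lambda_beta by (intro Bochner_Integration.integrable_sum ce(1))
  have "expectation (\<lambda>\<omega>. e \<omega> \<bullet> z \<omega>) = expectation (\<lambda>\<omega>. vec_cond_exp M G e \<omega> \<bullet> z \<omega>)"
    unfolding inner vec_cond_exp_def vec_lambda_beta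
    using int ce by (simp add: Bochner_Integration.integral_sum)
  also have "\<bar>\<dots>\<bar> \<le> expectation (\<lambda>\<omega>. \<bar>vec_cond_exp M G e \<omega> \<bullet> z \<omega>\<bar>)"
    by (rule integral_abs_bound)
  also have "\<dots> \<le> expectation (\<lambda>_. \<mu> * D)"
  proof (rule integral_mono_AE)
    show "AE \<omega> in M. \<bar>vec_cond_exp M G e \<omega> \<bullet> z \<omega>\<bar> \<le> \<mu> * D"
      using bound AE_space
    proof eventually_elim
      case (elim \<omega>)
      have "\<bar>vec_cond_exp M G e \<omega> \<bullet> z \<omega>\<bar> \<le> norm (vec_cond_exp M G e \<omega>) * norm (z \<omega>)"
        by (rule Cauchy_Schwarz_ineq2)
      also have "\<dots> \<le> \<mu> * D"
        using elim z_bound norm_ge_zero order_trans by (intro mult_mono) blast+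
      finally show ?case .
    qed
  qed (use int' in auto)
  finally show "\<bar>expectation (\<lambda>\<omega>. e \<omega> \<bullet> z \<omega>)\<bar> \<le> \<mu> * D" by (simp add: prob_space)
qed

section \<open>Series and minimizing sequences\<close>

lemma summable_decrements:
  fixes a b c :: "nat \<Rightarrow> real"
  assumes rec: "\<And>k. a (k + 1) \<le> a k - b k + c k"
    and nonneg: "\<And>k. a k \<ge> 0" "\<And>k. b k \<ge> 0" "\<And>k. c k \<ge> 0" and "summable c"
  shows "summable b"
proof (rule summableI_nonneg_bounded)
  fix n
  have "(\<Sum>k<n. b k) \<le> a 0 - a n + (\<Sum>k<n. c k)"
  proof (induction n)
    case (Suc n)
    then show ?case using rec[of n] by simp
  qed simp
  also have "\<dots> \<le> a 0 + suminf c"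
    using nonneg(1)[of n] nonneg(3) sum_le_suminf[OF \<open>summable c\<close>, of "{..<n}"] by simp
  finally show "(\<Sum>k<n. b k) \<le> a 0 + suminf c" .
qed (rule nonneg)

lemma summable_convolution:
  fixes \<rho> b :: "nat \<Rightarrow> real"
  assumes "summable \<rho>" "summable b" and nonneg: "\<And>k. \<rho> k \<ge> 0" "\<And>k. b k \<ge> 0"
  shows "summable (\<lambda>k. \<Sum>l<k. \<rho> (k - l) * b l)"
proof (rule summable_comparison_test')
  show "summable (\<lambda>k. \<Sum>l\<le>k. b l * \<rho> (k - l))"
    using assms by (intro summable_Cauchy_product) auto
  show "norm (\<Sum>l<k. \<rho> (k - l) * b l) \<le> (\<Sum>l\<le>k. b l * \<rho> (k - l))" for k
    using nonneg by (auto simp: sum_nonneg mult.commute lessThan_Suc_atMost[symmetric])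
qed

lemma power_stepsize:
  fixes a p :: real
  assumes "a > 0" "1 / 2 < p" "p \<le> 1" and A: "\<And>k. A k = a / real (k + 1) powr p"
  shows "A k > 0" "l \<le> k \<Longrightarrow> A k \<le> A l" "summable (\<lambda>k. (A k)\<^sup>2)" "\<not> summable A"
proof -
  show "A k > 0" unfolding A using \<open>a > 0\<close> by simp
  show "A k \<le> A l" if "l \<le> k"
    unfolding A using assms that by (intro divide_left_mono powr_mono2) auto
  have shift: "summable (\<lambda>k. real (k + 1) powr r) \<longleftrightarrow> r < -1" for r
    using summable_iff_shift[of "\<lambda>k. real k powr r" 1] summable_real_powr_iff[of r] by simp
  have A_powr: "A = (\<lambda>k. a * real (k + 1) powr (- p))"
    by (intro ext) (simp add: A powr_minus divide_simps)
  show "\<not> summable A"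
    using shift[of "- p"] assms(1,3) unfolding A_powr by (simp add: summable_cmult_iff)
  have "(\<lambda>k. (A k)\<^sup>2) = (\<lambda>k. a\<^sup>2 * real (k + 1) powr (- (2 * p)))"
    by (intro ext) (simp add: A powr_minus divide_simps power_mult_distrib power2_eq_square flip: powr_add)
  then show "summable (\<lambda>k. (A k)\<^sup>2)"
    using shift[of "- (2 * p)"] assms by (simp add: summable_mult)
qed

text \<open>
  By monotone convergence the sum of the series has finite integral.
\<close>
lemma AE_summable_if_summable_integrals:
  fixes h :: "nat \<Rightarrow> 'a \<Rightarrow> real"
  assumes int: "\<And>k. integrable M (h k)" and nonneg: "\<And>k \<omega>. \<omega> \<in> space M \<Longrightarrow> h k \<omega> \<ge> 0"
    and "summable (\<lambda>k. \<integral>\<omega>. h k \<omega> \<partial>M)"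
  shows "AE \<omega> in M. summable (\<lambda>k. h k \<omega>)"
proof -
  have [measurable]: "h k \<in> borel_measurable M" for k using int by auto
  have ge0: "(\<integral>\<omega>. h k \<omega> \<partial>M) \<ge> 0" for k
    using nonneg by (intro integral_nonneg_AE) auto
  have "(\<integral>\<^sup>+\<omega>. (\<Sum>k. ennreal (h k \<omega>)) \<partial>M) = (\<Sum>k. \<integral>\<^sup>+\<omega>. ennreal (h k \<omega>) \<partial>M)"
    by (rule nn_integral_suminf) simp
  also have "\<dots> = (\<Sum>k. ennreal (\<integral>\<omega>. h k \<omega> \<partial>M))"
    using int nonneg by (intro suminf_cong nn_integral_eq_integral) auto
  also have "\<dots> = ennreal (\<Sum>k. \<integral>\<omega>. h k \<omega> \<partial>M)"
    by (rule suminf_ennreal2[OF ge0 assms(3)])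
  also have "\<dots> \<noteq> \<infinity>" by simp
  finally have "AE \<omega> in M. (\<Sum>k. ennreal (h k \<omega>)) \<noteq> \<infinity>"
    by (intro nn_integral_PInf_AE) auto
  then show ?thesis
    using AE_space by eventually_elim (auto intro!: summable_suminf_not_top nonneg)
qed

lemma liminf_eq_if_frequently_close:
  fixes u :: "nat \<Rightarrow> real"
  assumes "\<And>k. l \<le> u k" "\<And>e. e > 0 \<Longrightarrow> \<exists>\<^sub>F k in sequentially. u k < l + e"
  shows "liminf (\<lambda>k. ereal (u k)) = ereal l"
proof (rule antisym)
  show "ereal l \<le> liminf (\<lambda>k. ereal (u k))"
    using assms(1) by (intro Liminf_bounded) auto
  show "liminf (\<lambda>k. ereal (u k)) \<le> ereal l"
  proof (rule ccontr)
    assume "\<not> ?thesis"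
    then have "ereal l < liminf (\<lambda>k. ereal (u k))" by simp
    from ereal_dense2[OF this] obtain y where y: "ereal l < ereal y" "ereal y < liminf (\<lambda>k. ereal (u k))"
      by blast
    have "\<forall>\<^sub>F k in sequentially. ereal y < ereal (u k)"
      using y(2) by (rule less_LiminfD)
    then have "\<forall>\<^sub>F k in sequentially. \<not> u k < l + (y - l)"
      by eventually_elim simp
    then show False
      using assms(2)[of "y - l"] y(1) by (simp add: frequently_def)
  qed
qed

lemma min_value_attained:
  fixes F :: "'b::topological_space \<Rightarrow> real"
  assumes "compact X" "X \<noteq> {}" "continuous_on X F"
  shows "\<exists>y\<in>X. F y = min_value F X" "z \<in> X \<Longrightarrow> min_value F X \<le> F z"
proof -
  obtain y where y: "y \<in> X" "\<And>z. z \<in> X \<Longrightarrow> F y \<le> F z"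
    using continuous_attains_inf[OF assms] by auto
  then have eq: "min_value F X = F y"
    unfolding min_value_def by (intro Least_equality) auto
  show "\<exists>y\<in>X. F y = min_value F X" using y(1) eq by auto
  show "z \<in> X \<Longrightarrow> min_value F X \<le> F z" using y(2) eq by auto
qed

text \<open>
  If the values stayed above the minimum by a fixed \<open>e\<close>, the weighted gaps would dominate
  \<open>e\<close> times the divergent series of the weights. For the distances, compactness gives a
  positive gap on the points of \<open>X\<close> that are at least \<open>e\<close> away from the minimizers.
\<close>
lemma liminf_minimizing:
  fixes F :: "'b::euclidean_space \<Rightarrow> real"
  assumes X: "compact X" "X \<noteq> {}" "continuous_on X F"
    and y: "\<And>k. y k \<in> X"
    and \<alpha>: "\<And>k. \<alpha> k \<ge> 0" "\<not> summable \<alpha>" "summable (\<lambda>k. \<alpha> k * (F (y k) - min_value F X))"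
  shows "liminf (\<lambda>k. ereal (F (y k))) = ereal (min_value F X)"
    and "liminf (\<lambda>k. ereal (infdist (y k) (minimizers F X))) = 0"
proof -
  note min = min_value_attained[OF X]
  have close: "\<exists>\<^sub>F k in sequentially. F (y k) < min_value F X + e" if "e > 0" for e
  proof (rule ccontr)
    assume "\<not> ?thesis"
    then have "\<forall>\<^sub>F k in sequentially. norm (\<alpha> k) \<le> (\<alpha> k * (F (y k) - min_value F X)) / e"
      unfolding not_frequently
    proof eventually_elim
      case (elim k)
      then have "\<alpha> k * e \<le> \<alpha> k * (F (y k) - min_value F X)"
        using \<alpha>(1) by (intro mult_left_mono) auto
      then show ?case using \<alpha>(1)[of k] \<open>e > 0\<close> by (simp add: field_simps)
    qed
    then have "summable \<alpha>"
      by (rule summable_comparison_test_ev) (intro summable_divide \<alpha>(3))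
    with \<alpha>(2) show False by blast
  qed
  then show "liminf (\<lambda>k. ereal (F (y k))) = ereal (min_value F X)"
    using min(2) y by (intro liminf_eq_if_frequently_close) auto
  let ?S = "minimizers F X"
  have "liminf (\<lambda>k. ereal (infdist (y k) ?S)) = ereal 0"
  proof (rule liminf_eq_if_frequently_close)
    fix e :: real assume "e > 0"
    let ?far = "X \<inter> {z. infdist z ?S \<ge> e}"
    have far: "compact ?far"
      by (intro compact_Int_closed X closed_Collect_le continuous_intros)
    obtain \<delta> where \<delta>: "\<delta> > 0" "\<And>z. z \<in> ?far \<Longrightarrow> F z \<ge> min_value F X + \<delta>"
    proof (cases "?far = {}")
      case True
      then show thesis using that[of 1] by auto
    next
      case False
      then obtain z where z: "z \<in> ?far" "\<And>z'. z' \<in> ?far \<Longrightarrow> F z \<le> F z'"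
        using continuous_attains_inf[OF far False continuous_on_subset[OF X(3)]] by auto
      have "z \<notin> ?S" using z(1) \<open>e > 0\<close> by auto
      then have "F z > min_value F X" using z(1) min(2)[of z] by (auto simp: minimizers_def)
      then show thesis using that[of "F z - min_value F X"] z(2) by auto
    qed
    show "\<exists>\<^sub>F k in sequentially. infdist (y k) ?S < 0 + e"
      using close[OF \<delta>(1)]
    proof (rule frequently_elim1)
      fix k assume "F (y k) < min_value F X + \<delta>"
      then have "y k \<notin> ?far" using \<delta>(2) by force
      then show "infdist (y k) ?S < 0 + e" using y by auto
    qed
  qed (rule infdist_nonneg)
  then show "liminf (\<lambda>k. ereal (infdist (y k) ?S)) = 0" by simp
qed

section \<open>Convergence of the method\<close>

theorem theorem4p3:
  fixes M :: "'a measure"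
    and X :: "(real ^ 'n) set"
    and f :: "'m::finite \<Rightarrow> real ^ 'n \<Rightarrow> real"
    and P :: "nat \<Rightarrow> real ^ 'm ^ 'm"
    and s :: "nat \<Rightarrow> 'a \<Rightarrow> 'm"
    and \<epsilon> :: "'m \<Rightarrow> nat \<Rightarrow> 'a \<Rightarrow> real ^ 'n"
    and x d :: "nat \<Rightarrow> 'a \<Rightarrow> real ^ 'n"
    and \<alpha> \<mu> \<nu> :: "nat \<Rightarrow> real"
    and a p \<eta> :: real
    and Q :: nat
  defines "F \<equiv> \<lambda>y. \<Sum>i\<in>UNIV. f i y"
    and "G \<equiv> history M (x 0) s (\<lambda>n \<omega>. \<epsilon> (s n \<omega>) n \<omega>)"
  assumes prob: "prob_space M"
    and X: "X \<noteq> {}" "closed X" "convex X" "bounded X"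
    and f_convex: "\<And>i. convex_on UNIV (f i)"
    and x0_measurable: "x 0 \<in> borel_measurable M"
    and s_measurable: "\<And>k. s k \<in> M \<rightarrow>\<^sub>M count_space UNIV"
    and eps_measurable: "\<And>k. (\<lambda>\<omega>. \<epsilon> (s (k + 1) \<omega>) (k + 1) \<omega>) \<in> borel_measurable M"
    and x0_in_X: "\<And>\<omega>. \<omega> \<in> space M \<Longrightarrow> x 0 \<omega> \<in> X"
    and subgradient: "\<And>k \<omega>. \<omega> \<in> space M \<Longrightarrow> is_subgradient (f (s (k + 1) \<omega>)) (x k \<omega>) (d k \<omega>)"
    and iteration: "\<And>k \<omega>. \<omega> \<in> space M \<Longrightarrow>
          x (k + 1) \<omega> = closest_point X (x k \<omega> - \<alpha> (k + 1) *\<^sub>R (d k \<omega> + \<epsilon> (s (k + 1) \<omega>) (k + 1) \<omega>))"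
    and x_adapted: "\<And>k. x k \<in> borel_measurable (G k)"
    and markov: "\<And>k j. AE \<omega> in M.
          real_cond_exp M (G k) (indicator {\<omega>' \<in> space M. s (k + 1) \<omega>' = j}) \<omega> = P k $ s k \<omega> $ j"
    and Q: "Q \<ge> 1" "\<And>k. strongly_connected (transition_graph P Q k)"
    and P_diag: "\<And>k i. P k $ i $ i > 0"
    and P_lower: "\<eta> > 0" "\<And>k i j. P k $ i $ j > 0 \<Longrightarrow> P k $ i $ j > \<eta>"
    and P_stochastic: "\<And>k. doubly_stochastic (P k)"
    and \<mu>_\<nu>_nonneg: "\<And>k. k \<ge> 1 \<Longrightarrow> \<mu> k \<ge> 0" "\<And>k. k \<ge> 1 \<Longrightarrow> \<nu> k \<ge> 0"
    and eps_mean: "\<And>k. AE \<omega> in M.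
          norm (vec_cond_exp M (G k) (\<lambda>\<omega>'. \<epsilon> (s (k + 1) \<omega>') (k + 1) \<omega>') \<omega>) \<le> \<mu> (k + 1)"
    and eps_second_moment: "\<And>k. AE \<omega> in M.
          nn_cond_exp M (G k) (\<lambda>\<omega>'. ennreal ((norm (\<epsilon> (s (k + 1) \<omega>') (k + 1) \<omega>'))\<^sup>2)) \<omega>
            \<le> ennreal ((\<nu> (k + 1))\<^sup>2)"
    and stepsize: "a > 0" "2 / 3 < p" "p \<le> 1" "\<And>k. k \<ge> 1 \<Longrightarrow> \<alpha> k = a / real k powr p"
    and \<mu>_summable: "summable (\<lambda>k. \<alpha> (k + 1) * \<mu> (k + 1))"
    and \<nu>_bounded: "bdd_above (\<nu> ` {1..})"
  shows "AE \<omega> in M.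
           liminf (\<lambda>k. ereal (F (x k \<omega>))) = ereal (min_value F X) \<and>
           liminf (\<lambda>k. ereal (infdist (x k \<omega>) (minimizers F X))) = 0"
proof -
  interpret prob_space M by (rule prob)
  let ?m = "real CARD('m)"
  define A where "A k = \<alpha> (k + 1)" for k
  define e where "e k \<omega> = \<epsilon> (s (k + 1) \<omega>) (k + 1) \<omega>" for k \<omega>
  have A_eq: "A k = a / real (k + 1) powr p" for k
    using stepsize(4)[of "k + 1"] by (simp add: A_def)
  have A_pos: "A k > 0" and A_mono: "l \<le> k \<Longrightarrow> A k \<le> A l" for k l
    using power_stepsize(1,2)[OF stepsize(1) _ stepsize(3) A_eq] stepsize(2) by auto
  have A_sq: "summable (\<lambda>k. (A k)\<^sup>2)" and A_div: "\<not> summable A"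
    using power_stepsize(3,4)[OF stepsize(1) _ stepsize(3) A_eq] stepsize(2) by auto
  have compact: "compact X" using X by (simp add: compact_eq_bounded_closed)
  have f_cont: "continuous_on UNIV (f i)" for i
    by (rule convex_on_continuous[OF open_UNIV f_convex])
  then have F_cont: "continuous_on UNIV F" unfolding F_def by (intro continuous_intros)
  have F_contX: "continuous_on X F" using F_cont continuous_on_subset by blast
  note F_min = min_value_attained[OF compact X(1) F_contX]
  obtain y where y: "y \<in> X" "F y = min_value F X" using F_min(1) by auto

  \<comment> \<open>One constant bounds all subgradients and all Lipschitz moduli on \<open>X\<close>.\<close>
  have "\<exists>L\<ge>0. (\<forall>z v. z \<in> X \<longrightarrow> is_subgradient (f i) z v \<longrightarrow> norm v \<le> L)
      \<and> (\<forall>z w. z \<in> X \<longrightarrow> w \<in> X \<longrightarrow> \<bar>f i z - f i w\<bar> \<le> L * norm (z - w))" for i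
    using convex_bounded_subgradient_lipschitz[OF f_convex[of i] X(4)] by metis
  then obtain l where l: "\<And>i. l i \<ge> 0"
    "\<And>i z v. z \<in> X \<Longrightarrow> is_subgradient (f i) z v \<Longrightarrow> norm v \<le> l i"
    "\<And>i z w. z \<in> X \<Longrightarrow> w \<in> X \<Longrightarrow> \<bar>f i z - f i w\<bar> \<le> l i * norm (z - w)" by metis
  define L where "L = (\<Sum>i\<in>UNIV. l i)"
  have L: "l i \<le> L" "L \<ge> 0" for i
    unfolding L_def using l(1) by (auto intro: member_le_sum sum_nonneg)
  have lip: "\<bar>f i z - f i w\<bar> \<le> L * norm (z - w)" if "z \<in> X" "w \<in> X" for i z w
    using l(3)[OF that, of i] mult_right_mono[OF L(1)[of i] norm_ge_zero[of "z - w"]] by linarith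
  obtain D where D: "\<And>z. z \<in> X \<Longrightarrow> norm (z - y) \<le> D"
    using bounded_translation_minus[OF X(4), of y] by (auto simp: bounded_iff)
  have "D \<ge> 0" using D[OF y(1)] by simp
  obtain V where V: "\<And>k. \<nu> (k + 1) \<le> V" using \<nu>_bounded by (force simp: bdd_above_def)
  have V_sq: "(\<nu> (k + 1))\<^sup>2 \<le> V\<^sup>2" for k
    using V[of k] \<mu>_\<nu>_nonneg(2)[of "k + 1"] by (intro power_mono) auto
  obtain C \<beta> where \<beta>: "0 \<le> C" "0 < \<beta>" "\<beta> < 1"
    and mix: "\<And>n t i j. \<bar>trans_prod P n t $ i $ j - 1 / ?m\<bar> \<le> C * \<beta> ^ t"
    using trans_prod_mixing[OF Q P_diag P_lower P_stochastic] by metis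
  define \<rho> where "\<rho> t = C * \<beta> ^ t" for t
  have \<rho>: "\<rho> t \<ge> 0" "summable \<rho>" for t
    unfolding \<rho>_def using \<beta> by (auto intro!: summable_mult summable_geometric)

  have e_meas [measurable]: "e k \<in> borel_measurable M" for k
    using eps_measurable[of k] unfolding e_def .
  have sub: "subalgebra M (G k)" for k
    unfolding G_def
  proof (rule subalgebra_history[OF x0_measurable s_measurable])
    show "(\<lambda>\<omega>. \<epsilon> (s n \<omega>) n \<omega>) \<in> borel_measurable M" if "n \<ge> 1" for n
      using eps_measurable[of "n - 1"] that by simp
  qed
  have s_adapted: "s k \<in> G k \<rightarrow>\<^sub>M count_space UNIV" for k
    unfolding G_def by (rule measurable_history_state)
  have x_meas [measurable]: "x k \<in> borel_measurable M" for k
    by (rule measurable_from_subalg[OF sub x_adapted])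
  note s_measurable [measurable]
  have f_meas [measurable]: "f i \<in> borel_measurable borel" for i
    by (rule borel_measurable_continuous_onI[OF f_cont])
  have iter: "x (k + 1) \<omega> = closest_point X (x k \<omega> - A k *\<^sub>R (d k \<omega> + e k \<omega>))" if "\<omega> \<in> space M" for k \<omega>
    unfolding A_def e_def by (rule iteration[OF that])
  have x_in: "x k \<omega> \<in> X" if "\<omega> \<in> space M" for k \<omega>
    using x0_in_X[OF that] iter[OF that] closest_point_in_set[OF X(2,1)] by (cases k) auto
  have d_bound: "norm (d k \<omega>) \<le> L" if "\<omega> \<in> space M" for k \<omega>
    using l(2)[OF x_in[OF that] subgradient[OF that]] L(1) order_trans by blast

  have "AE \<omega> in M. nn_cond_exp M (G k) (\<lambda>\<omega>'. ennreal ((norm (e k \<omega>'))\<^sup>2)) \<omega> \<le> ennreal ((\<nu> (k + 1))\<^sup>2)" for k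
    unfolding e_def by (rule eps_second_moment)
  note e_moment = conditional_second_moment_bound[OF sub e_meas this]
  have e_sq: "expectation (\<lambda>\<omega>. (norm (e k \<omega>))\<^sup>2) \<le> V\<^sup>2" for k
    using e_moment(2)[of k] V_sq[of k] by linarith
  \<comment> \<open>This elementary bound yields integrability of the error, and a bound on its mean norm, from its second moment.\<close>
  have norm_le_sq: "norm v \<le> 1 + (norm v)\<^sup>2" for v :: "real ^ 'n"
  proof -
    have "2 * norm v \<le> 1 + (norm v)\<^sup>2"
      using zero_le_power2[of "norm v - 1"] by (simp add: power2_diff)
    then show ?thesis using norm_ge_zero[of v] by linarith
  qed
  have e_int: "integrable M (e k)" for k
  proof (rule Bochner_Integration.integrable_bound)
    show "integrable M (\<lambda>\<omega>. 1 + (norm (e k \<omega>))\<^sup>2)"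
      by (intro Bochner_Integration.integrable_add e_moment(1)) simp
    have "norm (e k \<omega>) \<le> norm (1 + (norm (e k \<omega>))\<^sup>2)" for \<omega>
      using norm_le_sq[of "e k \<omega>"] by simp
    then show "AE \<omega> in M. norm (e k \<omega>) \<le> norm (1 + (norm (e k \<omega>))\<^sup>2)" by simp
  qed (rule e_meas)
  have e_norm: "expectation (\<lambda>\<omega>. norm (e k \<omega>)) \<le> 1 + V\<^sup>2" for k
  proof -
    have "expectation (\<lambda>\<omega>. norm (e k \<omega>)) \<le> expectation (\<lambda>\<omega>. 1 + (norm (e k \<omega>))\<^sup>2)"
    proof (rule integral_mono)
      show "integrable M (\<lambda>\<omega>. 1 + (norm (e k \<omega>))\<^sup>2)"
        by (intro Bochner_Integration.integrable_add e_moment(1)) simp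
    qed (use e_int in simp, rule norm_le_sq)
    then show ?thesis using e_sq[of k] e_moment(1)[of k] by (simp add: prob_space)
  qed

  define K where "K = L + 1 + V\<^sup>2"
  have K: "K \<ge> 0" using L by (simp add: K_def)
  have drift_int: "integrable M (\<lambda>\<omega>. norm (x (k + 1) \<omega> - x k \<omega>))" for k
  proof (rule integrable_real_bounded)
    show "\<bar>norm (x (k + 1) \<omega> - x k \<omega>)\<bar> \<le> 2 * D" if "\<omega> \<in> space M" for \<omega>
      using norm_triangle_ineq4[of "x (k + 1) \<omega> - y" "x k \<omega> - y"]
        D[OF x_in[OF that, of k]] D[OF x_in[OF that, of "k + 1"]] by simp
  qed measurable
  have drift: "expectation (\<lambda>\<omega>. norm (x (k + 1) \<omega> - x k \<omega>)) \<le> A k * K" for k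
  proof -
    have "expectation (\<lambda>\<omega>. norm (x (k + 1) \<omega> - x k \<omega>)) \<le> expectation (\<lambda>\<omega>. A k * (L + norm (e k \<omega>)))"
    proof (rule integral_mono[OF drift_int])
      fix \<omega> assume \<omega>: "\<omega> \<in> space M"
      have "norm (x (k + 1) \<omega> - x k \<omega>) \<le> norm (A k *\<^sub>R (d k \<omega> + e k \<omega>))"
        using closest_point_lipschitz[OF X(3,2,1), of "x k \<omega> - A k *\<^sub>R (d k \<omega> + e k \<omega>)" "x k \<omega>"]
          closest_point_self[OF x_in[OF \<omega>]] iter[OF \<omega>] by (simp add: dist_norm)
      also have "\<dots> \<le> A k * (L + norm (e k \<omega>))"
        using norm_triangle_ineq[of "d k \<omega>" "e k \<omega>"] d_bound[OF \<omega>, of k] A_pos[of k] by simp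
      finally show "norm (x (k + 1) \<omega> - x k \<omega>) \<le> A k * (L + norm (e k \<omega>))" .
    qed (use e_int in auto)
    also have "\<dots> \<le> A k * K"
      using e_norm[of k] e_int A_pos[of k] by (simp add: prob_space K_def)
    finally show ?thesis .
  qed

  \<comment> \<open>The components are shifted to vanish at the minimizer \<open>y\<close>. Their sum at \<open>x k\<close> is then the optimality
      gap \<open>h k\<close>, and Lipschitz continuity bounds each of them on \<open>X\<close>.\<close>
  define g where "g i z = f i z - f i y" for i z
  define h where "h k \<omega> = F (x k \<omega>) - min_value F X" for k \<omega>
  have h_eq: "h k \<omega> = (\<Sum>i\<in>UNIV. g i (x k \<omega>))" for k \<omega>
    unfolding h_def y(2)[symmetric] unfolding F_def g_def by (simp add: sum_subtractf)
  have g_bound: "\<bar>g i z\<bar> \<le> L * D" if "z \<in> X" for i z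
    using lip[OF that y(1), of i] mult_left_mono[OF D[OF that] L(2)] by (simp add: g_def)
  have g_meas [measurable]: "g i \<in> borel_measurable borel" for i
    unfolding g_def by measurable
  define bias where "bias k = ?m * (L * D * \<rho> (k + 1) + L * (\<Sum>l<k. \<rho> (k - l) * (A l * K)))" for k
  have bias: "\<bar>expectation (\<lambda>\<omega>. g (s (k + 1) \<omega>) (x k \<omega>)) - expectation (h k) / ?m\<bar> \<le> bias k" for k
    unfolding h_eq[abs_def] bias_def
  proof (rule markov_sampling_bias[where G = G and s = s and x = x and X = X and P = P])
    show "continuous_on UNIV (g j)" for j
      unfolding g_def by (intro continuous_intros f_cont)
    show "\<bar>g j z - g j w\<bar> \<le> L * norm (z - w)" if "z \<in> X" "w \<in> X" for j z w
      using lip[OF that, of j] by (simp add: g_def)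
    show "\<bar>trans_prod P n t $ i $ j - 1 / ?m\<bar> \<le> \<rho> t" for n t i j
      unfolding \<rho>_def by (rule mix)
  qed (fact sub s_adapted x_adapted x_in markov P_stochastic g_bound L(2) drift_int drift)+
  have h_meas [measurable]: "h k \<in> borel_measurable M" for k
    unfolding h_eq[abs_def] by measurable
  have h_nonneg: "h k \<omega> \<ge> 0" if "\<omega> \<in> space M" for k \<omega>
    using F_min(2)[OF x_in[OF that]] by (simp add: h_def)
  have h_int: "integrable M (h k)" for k
  proof (rule integrable_real_bounded)
    show "\<bar>h k \<omega>\<bar> \<le> (\<Sum>i\<in>(UNIV::'m set). L * D)" if "\<omega> \<in> space M" for \<omega>
      unfolding h_eq using g_bound[OF x_in[OF that]] by (intro order.trans[OF sum_abs] sum_mono)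
  qed measurable
  \<comment> \<open>Since \<open>A\<close> is decreasing, \<open>A k * A l \<le> (A l)\<^sup>2\<close> for \<open>l < k\<close>; up to constants, the weighted bias
      is thus at most \<open>\<rho> (k + 1)\<close> plus the convolution of \<open>\<rho>\<close> with the squares of the step sizes.\<close>
  have A_bias: "summable (\<lambda>k. A k * bias k)"
  proof (rule summable_comparison_test')
    show "summable (\<lambda>k. ?m * (L * D * A 0 * \<rho> (k + 1) + L * K * (\<Sum>l<k. \<rho> (k - l) * (A l)\<^sup>2)))"
      using \<rho> A_sq
      by (intro summable_mult summable_add summable_convolution) (auto simp: summable_Suc_iff)
    fix k
    have "A k * (\<Sum>l<k. \<rho> (k - l) * (A l * K)) = K * (\<Sum>l<k. \<rho> (k - l) * (A l * A k))"
      by (simp add: sum_distrib_left algebra_simps)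
    also have "\<dots> \<le> K * (\<Sum>l<k. \<rho> (k - l) * (A l)\<^sup>2)"
      using K \<rho> A_pos A_mono
      by (intro mult_left_mono sum_mono) (auto simp: power2_eq_square less_imp_le)
    finally have "L * (A k * (\<Sum>l<k. \<rho> (k - l) * (A l * K))) \<le> L * (K * (\<Sum>l<k. \<rho> (k - l) * (A l)\<^sup>2))"
      using L(2) by (rule mult_left_mono)
    moreover have "L * D * \<rho> (k + 1) * A k \<le> L * D * \<rho> (k + 1) * A 0"
      using L \<open>D \<ge> 0\<close> \<rho> A_mono[of 0 k] by (intro mult_left_mono) auto
    ultimately have "?m * (L * D * \<rho> (k + 1) * A k + L * (A k * (\<Sum>l<k. \<rho> (k - l) * (A l * K))))
        \<le> ?m * (L * D * \<rho> (k + 1) * A 0 + L * (K * (\<Sum>l<k. \<rho> (k - l) * (A l)\<^sup>2)))"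
      by (intro mult_left_mono[OF add_mono]) simp_all
    moreover have "A k * bias k \<ge> 0"
      using A_pos[of k] order_trans[OF abs_ge_zero bias[of k]] by simp
    ultimately show "norm (A k * bias k)
        \<le> ?m * (L * D * A 0 * \<rho> (k + 1) + L * K * (\<Sum>l<k. \<rho> (k - l) * (A l)\<^sup>2))"
      by (simp add: bias_def algebra_simps)
  qed

  \<comment> \<open>In \<open>c\<close> the three terms account for the sampling bias, the conditional mean of the errors and the
      squared length of the step.\<close>
  define r where "r k = expectation (\<lambda>\<omega>. (norm (x k \<omega> - y))\<^sup>2)" for k
  define c where "c k = 2 * (A k * bias k) + 2 * D * (A k * \<mu> (k + 1)) + (2 * L\<^sup>2 + 2 * V\<^sup>2) * (A k)\<^sup>2" for k
  have "AE \<omega> in M. norm (vec_cond_exp M (G k) (e k) \<omega>) \<le> \<mu> (k + 1)" for k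
    using eps_mean[of k] unfolding e_def[abs_def] .
  then have noise: "integrable M (\<lambda>\<omega>. e k \<omega> \<bullet> (x k \<omega> - y))"
      "\<bar>expectation (\<lambda>\<omega>. e k \<omega> \<bullet> (x k \<omega> - y))\<bar> \<le> \<mu> (k + 1) * D" for k
    using conditional_mean_inner_bound[OF sub[of k] e_int[of k], of "\<lambda>\<omega>. x k \<omega> - y" D "\<mu> (k + 1)"]
      x_adapted[of k] D x_in by auto
  have rec: "r (k + 1) \<le> r k - 2 / ?m * (A k * expectation (h k)) + c k" for k
  proof -
    have sq_int: "integrable M (\<lambda>\<omega>. (norm (x k \<omega> - y))\<^sup>2)" for k
      using D x_in by (auto intro!: integrable_real_bounded[where K = "D\<^sup>2"] power_mono)
    have g_int: "integrable M (\<lambda>\<omega>. g (s (k + 1) \<omega>) (x k \<omega>))"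
      using g_bound x_in by (auto intro!: integrable_real_bounded[where K = "L * D"])
    have gap: "g (s (k + 1) \<omega>) (x k \<omega>) \<le> d k \<omega> \<bullet> (x k \<omega> - y)" if "\<omega> \<in> space M" for \<omega>
      using subgradient[OF that, of k]
      by (auto simp: is_subgradient_def g_def inner_diff_right dest: spec[of _ y])
    have "r (k + 1) \<le> r k - 2 * A k * expectation (\<lambda>\<omega>. g (s (k + 1) \<omega>) (x k \<omega>))
        - 2 * A k * expectation (\<lambda>\<omega>. e k \<omega> \<bullet> (x k \<omega> - y))
        + (A k)\<^sup>2 * (2 * L\<^sup>2 + 2 * expectation (\<lambda>\<omega>. (norm (e k \<omega>))\<^sup>2))"
      unfolding r_def
    proof (rule expected_projected_step[where X = X and d = "d k"])
      show "A k \<ge> 0" using A_pos[of k] by simp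
    qed (fact X y iter gap d_bound g_int sq_int noise(1) e_moment(1))+
    also have "\<dots> \<le> r k - 2 * A k * (expectation (h k) / ?m - bias k)
        + 2 * A k * (\<mu> (k + 1) * D) + (A k)\<^sup>2 * (2 * L\<^sup>2 + 2 * V\<^sup>2)"
    proof -
      have "2 * A k * (expectation (h k) / ?m - bias k) \<le> 2 * A k * expectation (\<lambda>\<omega>. g (s (k + 1) \<omega>) (x k \<omega>))"
        using bias[of k] A_pos[of k] by (intro mult_left_mono) auto
      moreover have "2 * A k * - expectation (\<lambda>\<omega>. e k \<omega> \<bullet> (x k \<omega> - y)) \<le> 2 * A k * (\<mu> (k + 1) * D)"
        using noise(2)[of k] A_pos[of k] by (intro mult_left_mono) auto
      moreover have "(A k)\<^sup>2 * (2 * L\<^sup>2 + 2 * expectation (\<lambda>\<omega>. (norm (e k \<omega>))\<^sup>2)) \<le> (A k)\<^sup>2 * (2 * L\<^sup>2 + 2 * V\<^sup>2)"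
        using e_sq[of k] by (intro mult_left_mono) auto
      ultimately show ?thesis by linarith
    qed
    also have "\<dots> = r k - 2 / ?m * (A k * expectation (h k)) + c k"
      by (simp add: c_def algebra_simps)
    finally show ?thesis .
  qed
  have "summable (\<lambda>k. 2 / ?m * (A k * expectation (h k)))"
  proof (rule summable_decrements[where a = r and c = c])
    show "r k \<ge> 0" for k unfolding r_def by (intro integral_nonneg_AE) auto
    show "2 / ?m * (A k * expectation (h k)) \<ge> 0" for k
      using A_pos[of k] h_nonneg by (intro mult_nonneg_nonneg integral_nonneg_AE) auto
    show "c k \<ge> 0" for k
      unfolding c_def
      using A_pos[of k] order_trans[OF abs_ge_zero bias[of k]] \<open>D \<ge> 0\<close> \<mu>_\<nu>_nonneg(1)[of "k + 1"]
      by (intro add_nonneg_nonneg mult_nonneg_nonneg) auto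
    show "summable c"
      unfolding c_def using A_bias A_sq \<mu>_summable by (intro summable_add summable_mult) (auto simp: A_def)
  qed (rule rec)
  then have "summable (\<lambda>k. expectation (\<lambda>\<omega>. A k * h k \<omega>))"
    by (simp add: summable_cmult_iff)
  then have "AE \<omega> in M. summable (\<lambda>k. A k * h k \<omega>)"
    using h_int h_nonneg A_pos
    by (intro AE_summable_if_summable_integrals) (auto simp: less_imp_le)
  then show ?thesis
    using AE_space
  proof eventually_elim
    case (elim \<omega>)
    then show ?case
      using liminf_minimizing[OF compact X(1) F_contX x_in[OF elim(2)], of A] A_pos A_div
      by (auto simp: h_def less_imp_le)
  qed
qed

end
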